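(* Let $H$ be a weak bialgebra over the field $k$. Then the target counital subalgebra $H_t$ is Frobenius-separable with idempotent Frobenius system $$\bigl(\epsilon|_{H_t},\;(\epsilon_t\otimes \mathrm{id}_H)\Delta(1)\bigr).$$
   Context: $k$ is a field; algebras (unital, associative), coalgebras, $\otimes$ are over $k$; Sweedler notation $\Delta(h)=h_{(1)}\otimes h_{(2)}$, and $1_{(1)}\otimes 1_{(2)}=\Delta(1)$. Weak bialgebra: an algebra and coalgebra $H$ with $\Delta(gh)=\Delta(g)\Delta(h)$ and, for all $f,g,h\in H$: $\epsilon(fgh)=\epsilon(fg_{(1)})\epsilon(g_{(2)}h)=\epsilon(fg_{(2)})\epsilon(g_{(1)}h)$, and $1_{(1)}\otimes1_{(2)}\otimes1_{(3)}=(\Delta(1)\otimes1)(1\otimes\Delta(1))=(1\otimes\Delta(1))(\Delta(1)\otimes1)$. (Neither $\Delta(1)=1\otimes1$ nor multiplicativity of $\epsilon$ is required; $H$ need not be finite dimensional.) The target counital map is $\epsilon_t\colon H\to H$, $\epsilon_t(h)=\epsilon(1_{(1)}h)1_{(2)}$, and $H_t=\epsilon_t(H)$, which is a subalgebra of $H$, is the target counital subalgebra. Frobenius systems: A Frobenius system for a $k$-algebra $R$ is a pair $(\phi,e)$ of a linear map $\phi\colon R\to k$ and an element $e=e^{(1)}\otimes e^{(2)}\in R\otimes R$ (summation suppressed) with $r=\phi(re^{(1)})e^{(2)}=e^{(1)}\phi(e^{(2)}r)$ for all $r\in R$. It is an idempotent Frobenius system if moreover $e^{(1)}e^{(2)}=1$.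 $R$ is Frobenius-separable if an idempotent Frobenius system exists. *)

theory Defs
  imports Complex_Main "HOL-Library.Function_Algebras" "HOL-Library.FuncSet"
begin

section \<open>Tensor powers of a vector space\<close>

text \<open>
  Vector spaces over the field \<open>'k\<close> are given by a scalar multiplication \<open>s\<close> on a whole type.
  HOL has no tensor product. Here the pure tensor \<open>x \<otimes> y\<close> is evaluation of bilinear forms at
  \<open>(x, y)\<close>, and \<open>V \<otimes> V\<close> consists of the finite sums of pure tensors; likewise for
  \<open>V \<otimes> V \<otimes> V\<close> with trilinear forms. The lemmas \<open>bilinear_tensor\<close> and \<open>tensor_lift_sum\<close>
  (\<open>trilinear_tensor3\<close> and \<open>tensor3_lift_sum\<close> for three factors) give the universal property:
  the pure tensor is multilinear, and every multilinear map into an arbitrary vector space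
  factors through the tensors, uniquely since pure tensors generate.
\<close>

type_synonym ('k, 'v) tensor2 = "('v \<Rightarrow> 'v \<Rightarrow> 'k) \<Rightarrow> 'k"
type_synonym ('k, 'v) tensor3 = "('v \<Rightarrow> 'v \<Rightarrow> 'v \<Rightarrow> 'k) \<Rightarrow> 'k"

definition bilinear_map ::
  "('k::field \<Rightarrow> 'v::ab_group_add \<Rightarrow> 'v) \<Rightarrow> ('k \<Rightarrow> 'w::ab_group_add \<Rightarrow> 'w) \<Rightarrow> ('v \<Rightarrow> 'v \<Rightarrow> 'w) \<Rightarrow> bool"
  where "bilinear_map s sW \<beta> \<longleftrightarrow>
    (\<forall>y. Vector_Spaces.linear s sW (\<lambda>x. \<beta> x y)) \<and> (\<forall>x. Vector_Spaces.linear s sW (\<lambda>y. \<beta> x y))"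

definition trilinear_map ::
  "('k::field \<Rightarrow> 'v::ab_group_add \<Rightarrow> 'v) \<Rightarrow> ('k \<Rightarrow> 'w::ab_group_add \<Rightarrow> 'w) \<Rightarrow> ('v \<Rightarrow> 'v \<Rightarrow> 'v \<Rightarrow> 'w) \<Rightarrow> bool"
  where "trilinear_map s sW \<gamma> \<longleftrightarrow>
    (\<forall>y z. Vector_Spaces.linear s sW (\<lambda>x. \<gamma> x y z)) \<and>
    (\<forall>x z. Vector_Spaces.linear s sW (\<lambda>y. \<gamma> x y z)) \<and>
    (\<forall>x y. Vector_Spaces.linear s sW (\<lambda>z. \<gamma> x y z))"

definition tensor :: "('k::field \<Rightarrow> 'v::ab_group_add \<Rightarrow> 'v) \<Rightarrow> 'v \<Rightarrow> 'v \<Rightarrow> ('k, 'v) tensor2"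
  where "tensor s x y = (\<lambda>\<beta>. if bilinear_map s (*) \<beta> then \<beta> x y else 0)"

definition tensor3 :: "('k::field \<Rightarrow> 'v::ab_group_add \<Rightarrow> 'v) \<Rightarrow> 'v \<Rightarrow> 'v \<Rightarrow> 'v \<Rightarrow> ('k, 'v) tensor3"
  where "tensor3 s x y z = (\<lambda>\<gamma>. if trilinear_map s (*) \<gamma> then \<gamma> x y z else 0)"

definition tensor_scale :: "'k::field \<Rightarrow> ('b \<Rightarrow> 'k) \<Rightarrow> 'b \<Rightarrow> 'k"
  where "tensor_scale c t = (\<lambda>\<beta>. c * t \<beta>)"

text \<open>For subspaces \<open>R\<close>, \<open>S\<close> of \<open>V\<close>, this is \<open>R \<otimes> S\<close> regarded as a subspace of \<open>V \<otimes> V\<close>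
  (over a field, the canonical map between them is injective).\<close>

definition tensor_space ::
  "('k::field \<Rightarrow> 'v::ab_group_add \<Rightarrow> 'v) \<Rightarrow> 'v set \<Rightarrow> 'v set \<Rightarrow> ('k, 'v) tensor2 set"
  where "tensor_space s R S = {\<Sum>(x, y)\<leftarrow>ps. tensor s x y | ps. set ps \<subseteq> R \<times> S}"

text \<open>Sweedler summation: for \<open>t = \<Sum>i. x\<^sub>i \<otimes> y\<^sub>i\<close> in \<open>R \<otimes> S\<close>, the value
  \<open>tensor_lift s R S \<beta> t\<close> is \<open>\<Sum>i. \<beta> x\<^sub>i y\<^sub>i\<close>, that is \<open>\<beta> t\<^sup>(\<^sup>1\<^sup>) t\<^sup>(\<^sup>2\<^sup>)\<close>. It is independent of the
  chosen expression of \<open>t\<close> as soon as \<open>\<beta>\<close> is bilinear on \<open>R \<times> S\<close>; this matters for maps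
  that are only linear on \<open>R\<close> and \<open>S\<close>.\<close>

definition tensor_lift ::
  "('k::field \<Rightarrow> 'v::ab_group_add \<Rightarrow> 'v) \<Rightarrow> 'v set \<Rightarrow> 'v set \<Rightarrow>
   ('v \<Rightarrow> 'v \<Rightarrow> 'w::ab_group_add) \<Rightarrow> ('k, 'v) tensor2 \<Rightarrow> 'w"
  where "tensor_lift s R S \<beta> t = (THE w. \<exists>ps. set ps \<subseteq> R \<times> S \<and>
    t = (\<Sum>(x, y)\<leftarrow>ps. tensor s x y) \<and> w = (\<Sum>(x, y)\<leftarrow>ps. \<beta> x y))"

definition tensor3_lift ::
  "('k::field \<Rightarrow> 'v::ab_group_add \<Rightarrow> 'v) \<Rightarrow>
   ('v \<Rightarrow> 'v \<Rightarrow> 'v \<Rightarrow> 'w::ab_group_add) \<Rightarrow> ('k, 'v) tensor3 \<Rightarrow> 'w"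
  where "tensor3_lift s \<gamma> t = (THE w. \<exists>ps.
    t = (\<Sum>(x, y, z)\<leftarrow>ps. tensor3 s x y z) \<and> w = (\<Sum>(x, y, z)\<leftarrow>ps. \<gamma> x y z))"

abbreviation sweedler ::
  "('k::field \<Rightarrow> 'v::ab_group_add \<Rightarrow> 'v) \<Rightarrow>
   ('v \<Rightarrow> 'v \<Rightarrow> 'w::ab_group_add) \<Rightarrow> ('k, 'v) tensor2 \<Rightarrow> 'w"
  where "sweedler s \<equiv> tensor_lift s UNIV UNIV"

definition tensor_map ::
  "('k::field \<Rightarrow> 'v::ab_group_add \<Rightarrow> 'v) \<Rightarrow> ('v \<Rightarrow> 'v) \<Rightarrow> ('v \<Rightarrow> 'v) \<Rightarrow> ('k, 'v) tensor2 \<Rightarrow> ('k, 'v) tensor2"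
  where "tensor_map s f g t = sweedler s (\<lambda>x y. tensor s (f x) (g y)) t"

lemma sum_list_apply: "(\<Sum>p\<leftarrow>ps. F p) x = (\<Sum>p\<leftarrow>ps. F p x)"
  for F :: "'a \<Rightarrow> 'b \<Rightarrow> 'c::comm_monoid_add"
  by (induction ps) auto

lemma vector_space_tensor_scale: "vector_space tensor_scale"
  by unfold_locales (auto simp: tensor_scale_def fun_eq_iff algebra_simps)

lemma vector_space_times: "vector_space ((*) :: 'k::field \<Rightarrow> 'k \<Rightarrow> 'k)"
  by unfold_locales (auto simp: algebra_simps)

lemma linear_iff_vs:
  "Vector_Spaces.linear s1 s2 f \<longleftrightarrow> vector_space s1 \<and> vector_space s2 \<and>
    (\<forall>x y. f (x + y) = f x + f y) \<and> (\<forall>c x. f (s1 c x) = s2 c (f x))"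
  unfolding Vector_Spaces.linear_def module_hom_def module_hom_axioms_def
  by (auto simp: module_iff_vector_space)

lemma bilinear_tensor:
  assumes "vector_space s"
  shows "bilinear_map s tensor_scale (tensor s)"
  using assms vector_space_tensor_scale
  by (auto simp: bilinear_map_def linear_iff_vs tensor_def tensor_scale_def fun_eq_iff)

lemma trilinear_tensor3:
  assumes "vector_space s"
  shows "trilinear_map s tensor_scale (tensor3 s)"
  using assms vector_space_tensor_scale
  by (auto simp: trilinear_map_def linear_iff_vs tensor3_def tensor_scale_def fun_eq_iff)

lemma eq_by_functionals:
  fixes sW :: "'k::field \<Rightarrow> 'w::ab_group_add \<Rightarrow> 'w"
  assumes W: "vector_space sW"
    and eq: "\<And>\<psi>. Vector_Spaces.linear sW (*) \<psi> \<Longrightarrow> \<psi> v = \<psi> w"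
  shows "v = w"
proof (rule ccontr)
  assume "v \<noteq> w"
  interpret p: vector_space_pair sW "(*) :: 'k \<Rightarrow> 'k \<Rightarrow> 'k"
    using W vector_space_times by (rule vector_space_pair.intro)
  have "p.vs1.independent {v - w}"
    using \<open>v \<noteq> w\<close> by simp
  from p.linear_independent_extend[OF this, of "\<lambda>_. 1"]
  obtain \<psi> where \<psi>: "Vector_Spaces.linear sW (*) \<psi>" "\<psi> (v - w) = 1"
    by auto
  then interpret \<psi>: Vector_Spaces.linear sW "(*)" \<psi>
    by simp
  show False
    using \<psi> eq[OF \<psi>(1)] by (simp add: \<psi>.diff)
qed

lemma projection_onto_subspace:
  fixes s :: "'k::field \<Rightarrow> 'v::ab_group_add \<Rightarrow> 'v"
  assumes V: "vector_space s" and R: "module.subspace s R"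
  obtains p where "Vector_Spaces.linear s s p" "range p \<subseteq> R" "\<And>x. x \<in> R \<Longrightarrow> p x = x"
proof -
  interpret p: vector_space_pair s s
    using V V by (rule vector_space_pair.intro)
  have "Vector_Spaces.linear s s id"
    using V by (auto simp: linear_iff_vs)
  from p.linear_exists_left_inverse_on[OF this R]
  obtain g where "g ` UNIV \<subseteq> R" "Vector_Spaces.linear s s g" "\<forall>v\<in>R. g (id v) = v"
    by auto
  then show thesis
    using that by auto
qed

lemma linear_sum_list:
  assumes "Vector_Spaces.linear s1 s2 f"
  shows "f (\<Sum>p\<leftarrow>ps. F p) = (\<Sum>p\<leftarrow>ps. f (F p))"
proof -
  interpret f: Vector_Spaces.linear s1 s2 f by fact
  show ?thesis by (induction ps) (auto simp: f.add f.zero)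
qed

lemma tensor_lift_sum:
  fixes s :: "'k::field \<Rightarrow> 'v::ab_group_add \<Rightarrow> 'v"
    and sW :: "'k \<Rightarrow> 'w::ab_group_add \<Rightarrow> 'w"
  assumes V: "vector_space s" and W: "vector_space sW"
    and R: "module.subspace s R" and S: "module.subspace s S"
    and add1: "\<And>x x' y. x \<in> R \<Longrightarrow> x' \<in> R \<Longrightarrow> y \<in> S \<Longrightarrow> \<beta> (x + x') y = \<beta> x y + \<beta> x' y"
    and add2: "\<And>x y y'. x \<in> R \<Longrightarrow> y \<in> S \<Longrightarrow> y' \<in> S \<Longrightarrow> \<beta> x (y + y') = \<beta> x y + \<beta> x y'"
    and scale1: "\<And>c x y. x \<in> R \<Longrightarrow> y \<in> S \<Longrightarrow> \<beta> (s c x) y = sW c (\<beta> x y)"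
    and scale2: "\<And>c x y. x \<in> R \<Longrightarrow> y \<in> S \<Longrightarrow> \<beta> x (s c y) = sW c (\<beta> x y)"
    and ps: "set ps \<subseteq> R \<times> S"
  shows "tensor_lift s R S \<beta> (\<Sum>(x, y)\<leftarrow>ps. tensor s x y) = (\<Sum>(x, y)\<leftarrow>ps. \<beta> x y)"
proof -
  obtain p where p: "Vector_Spaces.linear s s p" "range p \<subseteq> R" "\<And>x. x \<in> R \<Longrightarrow> p x = x"
    using projection_onto_subspace[OF V R] by blast
  obtain q where q: "Vector_Spaces.linear s s q" "range q \<subseteq> S" "\<And>x. x \<in> S \<Longrightarrow> q x = x"
    using projection_onto_subspace[OF V S] by blast
  have pR: "p x \<in> R" and qS: "q x \<in> S" for x
    using p(2) q(2) by auto
  have "(\<Sum>(x, y)\<leftarrow>qs. \<beta> x y) = (\<Sum>(x, y)\<leftarrow>ps. \<beta> x y)"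
    if qs: "set qs \<subseteq> R \<times> S"
      and eq: "(\<Sum>(x, y)\<leftarrow>qs. tensor s x y) = (\<Sum>(x, y)\<leftarrow>ps. tensor s x y)" for qs
  proof (rule eq_by_functionals[OF W])
    fix \<psi> assume \<psi>: "Vector_Spaces.linear sW (*) \<psi>"
    define b where "b = (\<lambda>x y. \<psi> (\<beta> (p x) (q y)))"
    have b: "bilinear_map s (*) b"
      using p(1) q(1) \<psi> V unfolding bilinear_map_def linear_iff_vs b_def
      by (simp add: add1 add2 scale1 scale2 pR qS)
    have tb: "tensor s x y b = \<psi> (\<beta> (p x) (q y))" for x y
      using b by (simp only: tensor_def if_True) (simp add: b_def)
    have *: "(\<Sum>(x, y)\<leftarrow>rs. tensor s x y) b = \<psi> (\<Sum>(x, y)\<leftarrow>rs. \<beta> x y)"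
      if "set rs \<subseteq> R \<times> S" for rs
    proof -
      have "(\<Sum>(x, y)\<leftarrow>rs. tensor s x y) b = (\<Sum>z\<leftarrow>rs. \<psi> (case z of (x, y) \<Rightarrow> \<beta> x y))"
        unfolding sum_list_apply using that
        by (intro arg_cong[where f = sum_list] map_cong) (auto simp: tb p(3) q(3))
      also have "\<dots> = \<psi> (\<Sum>(x, y)\<leftarrow>rs. \<beta> x y)"
        using linear_sum_list[OF \<psi>] by metis
      finally show ?thesis .
    qed
    show "\<psi> (\<Sum>(x, y)\<leftarrow>qs. \<beta> x y) = \<psi> (\<Sum>(x, y)\<leftarrow>ps. \<beta> x y)"
      using *[OF qs] *[OF ps] eq by simp
  qed
  then show ?thesis
    unfolding tensor_lift_def using ps by (intro the_equality) (metis, metis)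
qed

lemma tensor3_lift_sum:
  fixes s :: "'k::field \<Rightarrow> 'v::ab_group_add \<Rightarrow> 'v"
    and sW :: "'k \<Rightarrow> 'w::ab_group_add \<Rightarrow> 'w"
  assumes W: "vector_space sW" and \<gamma>: "trilinear_map s sW \<gamma>"
  shows "tensor3_lift s \<gamma> (\<Sum>(x, y, z)\<leftarrow>ps. tensor3 s x y z) = (\<Sum>(x, y, z)\<leftarrow>ps. \<gamma> x y z)"
proof -
  have "(\<Sum>(x, y, z)\<leftarrow>qs. \<gamma> x y z) = (\<Sum>(x, y, z)\<leftarrow>ps. \<gamma> x y z)"
    if eq: "(\<Sum>(x, y, z)\<leftarrow>qs. tensor3 s x y z) = (\<Sum>(x, y, z)\<leftarrow>ps. tensor3 s x y z)" for qs
  proof (rule eq_by_functionals[OF W])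
    fix \<psi> assume \<psi>: "Vector_Spaces.linear sW (*) \<psi>"
    define b where "b = (\<lambda>x y z. \<psi> (\<gamma> x y z))"
    have b: "trilinear_map s (*) b"
      using \<psi> \<gamma> unfolding trilinear_map_def linear_iff_vs b_def by simp
    have tb: "tensor3 s x y z b = \<psi> (\<gamma> x y z)" for x y z
      using b by (simp only: tensor3_def if_True) (simp add: b_def)
    have *: "(\<Sum>(x, y, z)\<leftarrow>rs. tensor3 s x y z) b = \<psi> (\<Sum>(x, y, z)\<leftarrow>rs. \<gamma> x y z)" for rs
    proof -
      have "(\<Sum>(x, y, z)\<leftarrow>rs. tensor3 s x y z) b = (\<Sum>t\<leftarrow>rs. \<psi> (case t of (x, y, z) \<Rightarrow> \<gamma> x y z))"
        unfolding sum_list_apply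
        by (intro arg_cong[where f = sum_list] map_cong) (auto simp: tb)
      also have "\<dots> = \<psi> (\<Sum>(x, y, z)\<leftarrow>rs. \<gamma> x y z)"
        using linear_sum_list[OF \<psi>] by metis
      finally show ?thesis .
    qed
    show "\<psi> (\<Sum>(x, y, z)\<leftarrow>qs. \<gamma> x y z) = \<psi> (\<Sum>(x, y, z)\<leftarrow>ps. \<gamma> x y z)"
      using *[of qs] *[of ps] eq by simp
  qed
  then show ?thesis
    unfolding tensor3_lift_def by (intro the_equality) (metis, metis)
qed


section \<open>Algebras and Frobenius systems\<close>

text \<open>The sort \<open>{ring, monoid_mult}\<close>, unlike \<open>ring_1\<close>, does not exclude the zero algebra.\<close>

locale unital_algebra = vector_space scale
  for scale :: "'k::field \<Rightarrow> 'h::{ring, monoid_mult} \<Rightarrow> 'h" +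
  assumes scale_mult_left: "scale c x * y = scale c (x * y)"
    and scale_mult_right: "x * scale c y = scale c (x * y)"

definition mult_tensor ::
  "('k::field \<Rightarrow> 'h::{ring, monoid_mult} \<Rightarrow> 'h) \<Rightarrow> ('k, 'h) tensor2 \<Rightarrow> ('k, 'h) tensor2 \<Rightarrow> ('k, 'h) tensor2"
  where "mult_tensor s t u =
    sweedler s (\<lambda>a b. sweedler s (\<lambda>c d. tensor s (a * c) (b * d)) u) t"

definition mult_tensor3 ::
  "('k::field \<Rightarrow> 'h::{ring, monoid_mult} \<Rightarrow> 'h) \<Rightarrow> ('k, 'h) tensor3 \<Rightarrow> ('k, 'h) tensor3 \<Rightarrow> ('k, 'h) tensor3"
  where "mult_tensor3 s t u =
    tensor3_lift s (\<lambda>a b c. tensor3_lift s (\<lambda>a' b' c'. tensor3 s (a * a') (b * b') (c * c')) u) t"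

definition subalgebra :: "('k::field \<Rightarrow> 'h::{ring, monoid_mult} \<Rightarrow> 'h) \<Rightarrow> 'h set \<Rightarrow> bool"
  where "subalgebra s R \<longleftrightarrow>
    unital_algebra s \<and> module.subspace s R \<and> 1 \<in> R \<and> (\<forall>x\<in>R. \<forall>y\<in>R. x * y \<in> R)"

text \<open>Frobenius systems for the algebra \<open>R\<close>, which is carried by a subalgebra of an algebra
  type (possibly \<open>UNIV\<close>). Only the values of \<open>\<phi>\<close> on \<open>R\<close> matter.\<close>

definition frobenius_system ::
  "('k::field \<Rightarrow> 'h::{ring, monoid_mult} \<Rightarrow> 'h) \<Rightarrow> 'h set \<Rightarrow> ('h \<Rightarrow> 'k) \<Rightarrow> ('k, 'h) tensor2 \<Rightarrow> bool"
  where "frobenius_system s R \<phi> e \<longleftrightarrow>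
    subalgebra s R \<and>
    (\<forall>x\<in>R. \<forall>y\<in>R. \<phi> (x + y) = \<phi> x + \<phi> y) \<and> (\<forall>c. \<forall>x\<in>R. \<phi> (s c x) = c * \<phi> x) \<and>
    e \<in> tensor_space s R R \<and>
    (\<forall>r\<in>R. r = tensor_lift s R R (\<lambda>e1 e2. s (\<phi> (r * e1)) e2) e \<and>
           r = tensor_lift s R R (\<lambda>e1 e2. s (\<phi> (e2 * r)) e1) e)"

definition idempotent_frobenius_system ::
  "('k::field \<Rightarrow> 'h::{ring, monoid_mult} \<Rightarrow> 'h) \<Rightarrow> 'h set \<Rightarrow> ('h \<Rightarrow> 'k) \<Rightarrow> ('k, 'h) tensor2 \<Rightarrow> bool"
  where "idempotent_frobenius_system s R \<phi> e \<longleftrightarrow>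
    frobenius_system s R \<phi> e \<and> tensor_lift s R R (\<lambda>e1 e2. e1 * e2) e = 1"

definition frobenius_separable :: "('k::field \<Rightarrow> 'h::{ring, monoid_mult} \<Rightarrow> 'h) \<Rightarrow> 'h set \<Rightarrow> bool"
  where "frobenius_separable s R \<longleftrightarrow> (\<exists>\<phi> e. idempotent_frobenius_system s R \<phi> e)"


section \<open>Weak bialgebras\<close>

locale coalgebra = vector_space scale
  for scale :: "'k::field \<Rightarrow> 'h::ab_group_add \<Rightarrow> 'h" +
  fixes \<Delta> :: "'h \<Rightarrow> ('k, 'h) tensor2" and \<epsilon> :: "'h \<Rightarrow> 'k"
  assumes comult_in: "\<Delta> h \<in> tensor_space scale UNIV UNIV"
    and linear_comult: "Vector_Spaces.linear scale tensor_scale \<Delta>"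
    and linear_counit: "Vector_Spaces.linear scale (*) \<epsilon>"
    and coassoc:
      "sweedler scale (\<lambda>a b. sweedler scale (\<lambda>a1 a2. tensor3 scale a1 a2 b) (\<Delta> a)) (\<Delta> h) =
       sweedler scale (\<lambda>a b. sweedler scale (\<lambda>b1 b2. tensor3 scale a b1 b2) (\<Delta> b)) (\<Delta> h)"
    and counit_left: "sweedler scale (\<lambda>a b. scale (\<epsilon> a) b) (\<Delta> h) = h"
    and counit_right: "sweedler scale (\<lambda>a b. scale (\<epsilon> b) a) (\<Delta> h) = h"

text \<open>In \<open>unit_left\<close> and \<open>unit_right\<close>, the left-hand side is \<open>(\<Delta> \<otimes> id) (\<Delta> 1)\<close>, and the two
  factors on the right are \<open>\<Delta> 1 \<otimes> 1\<close> and \<open>1 \<otimes> \<Delta> 1\<close>.\<close>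

locale weak_bialgebra = unital_algebra scale + coalgebra scale \<Delta> \<epsilon>
  for scale :: "'k::field \<Rightarrow> 'h::{ring, monoid_mult} \<Rightarrow> 'h"
    and \<Delta> :: "'h \<Rightarrow> ('k, 'h) tensor2" and \<epsilon> :: "'h \<Rightarrow> 'k" +
  assumes comult_mult: "\<Delta> (g * h) = mult_tensor scale (\<Delta> g) (\<Delta> h)"
    and counit_mult: "\<epsilon> (f * g * h) = sweedler scale (\<lambda>g1 g2. \<epsilon> (f * g1) * \<epsilon> (g2 * h)) (\<Delta> g)"
    and counit_mult': "\<epsilon> (f * g * h) = sweedler scale (\<lambda>g1 g2. \<epsilon> (f * g2) * \<epsilon> (g1 * h)) (\<Delta> g)"
    and unit_left:
      "sweedler scale (\<lambda>a b. sweedler scale (\<lambda>a1 a2. tensor3 scale a1 a2 b) (\<Delta> a)) (\<Delta> 1) =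
       mult_tensor3 scale (sweedler scale (\<lambda>a b. tensor3 scale a b 1) (\<Delta> 1))
                          (sweedler scale (\<lambda>a b. tensor3 scale 1 a b) (\<Delta> 1))"
    and unit_right:
      "sweedler scale (\<lambda>a b. sweedler scale (\<lambda>a1 a2. tensor3 scale a1 a2 b) (\<Delta> a)) (\<Delta> 1) =
       mult_tensor3 scale (sweedler scale (\<lambda>a b. tensor3 scale 1 a b) (\<Delta> 1))
                          (sweedler scale (\<lambda>a b. tensor3 scale a b 1) (\<Delta> 1))"

definition target_counital ::
  "('k::field \<Rightarrow> 'h::{ring, monoid_mult} \<Rightarrow> 'h) \<Rightarrow> ('h \<Rightarrow> ('k, 'h) tensor2) \<Rightarrow> ('h \<Rightarrow> 'k) \<Rightarrow> 'h \<Rightarrow> 'h"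
  where "target_counital s \<Delta> \<epsilon> h = sweedler s (\<lambda>a b. s (\<epsilon> (a * h)) b) (\<Delta> 1)"

definition target_subalgebra ::
  "('k::field \<Rightarrow> 'h::{ring, monoid_mult} \<Rightarrow> 'h) \<Rightarrow> ('h \<Rightarrow> ('k, 'h) tensor2) \<Rightarrow> ('h \<Rightarrow> 'k) \<Rightarrow> 'h set"
  where "target_subalgebra s \<Delta> \<epsilon> = range (target_counital s \<Delta> \<epsilon>)"

end

theory Submission
  imports Defs
begin

text \<open>
  Write \<open>\<Delta> 1 = \<Sum> a \<otimes> b = \<Sum> c \<otimes> d\<close>. The unit axioms give
  \<open>\<Sum> a \<otimes> b c \<otimes> d = \<Sum> a \<otimes> c b \<otimes> d = \<Sum> a \<otimes> \<Delta> b\<close>. Contracting the middle leg with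
  \<open>\<epsilon>\<close> yields \<open>\<Delta> 1 = \<Sum> a \<otimes> \<epsilon>\<^sub>t b\<close>, so that \<open>(\<epsilon>\<^sub>t \<otimes> id) (\<Delta> 1)\<close> lies in \<open>H\<^sub>t \<otimes> H\<^sub>t\<close>;
  contracting the first leg with \<open>\<epsilon> (_ h)\<close> yields \<open>\<Delta> z = \<Sum> a z \<otimes> b\<close> for \<open>z = \<epsilon>\<^sub>t h\<close>, hence
  \<open>H\<^sub>t\<close> is closed under products. Since \<open>\<epsilon> (g \<epsilon>\<^sub>t(h)) = \<epsilon> (g h)\<close>, the first Frobenius
  identity reads \<open>\<Sum> \<epsilon>(z a) b = z\<close>; expanding \<open>z = \<Sum> \<epsilon>(a z) b\<close>, it follows from the
  exchange of \<open>b c\<close> and \<open>c b\<close> above. The second one is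
  \<open>\<Sum> \<epsilon>(b z) \<epsilon>\<^sub>t(a) = \<Sum> \<epsilon>(c a) \<epsilon>(b z) d = \<Sum> \<epsilon>(c z) d = z\<close>, and
  \<open>\<Sum> \<epsilon>\<^sub>t(a) b = (\<epsilon> \<otimes> id) (\<Delta>(1) \<Delta>(1)) = 1\<close>.
\<close>

section \<open>Sums over lists of pairs, as concrete Sweedler sums\<close>

definition pair_sum :: "('a \<times> 'b) list \<Rightarrow> ('a \<Rightarrow> 'b \<Rightarrow> 'c::comm_monoid_add) \<Rightarrow> 'c"
  where "pair_sum ps F = (\<Sum>(x, y)\<leftarrow>ps. F x y)"

lemma pair_sum_Nil [simp]: "pair_sum [] F = 0"
  by (simp add: pair_sum_def)

lemma pair_sum_Cons [simp]: "pair_sum (p # ps) F = F (fst p) (snd p) + pair_sum ps F"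
  by (simp add: pair_sum_def case_prod_unfold)

lemma pair_sum_zero: "pair_sum ps (\<lambda>x y. 0) = 0"
  by (induction ps) simp_all

lemma pair_sum_apply: "pair_sum ps F z = pair_sum ps (\<lambda>x y. F x y z)"
  by (induction ps) simp_all

lemma pair_sum_add:
  "pair_sum ps (\<lambda>x y. F x y + G x y) = pair_sum ps F + pair_sum ps G"
  by (induction ps) (simp_all add: ac_simps)

lemma pair_sum_swap:
  "pair_sum ps (\<lambda>x y. pair_sum qs (F x y)) =
    pair_sum qs (\<lambda>z w. pair_sum ps (\<lambda>x y. F x y z w))"
  by (induction ps) (simp_all add: pair_sum_zero pair_sum_add)

lemma linear_pair_sum:
  assumes "Vector_Spaces.linear s1 s2 f"
  shows "f (pair_sum ps F) = pair_sum ps (\<lambda>x y. f (F x y))"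
  using linear_sum_list[OF assms, of "\<lambda>(x, y). F x y"]
  by (simp add: pair_sum_def case_prod_unfold)

lemma pair_sum_scale:
  assumes "vector_space sW"
  shows "pair_sum ps (\<lambda>x y. sW c (F x y)) = sW c (pair_sum ps F)"
proof -
  interpret vector_space sW by fact
  show ?thesis by (induction ps) (simp_all add: scale_right_distrib)
qed

lemma linear_pair_sumI:
  assumes "vector_space s1" "vector_space s2"
    and lin: "\<And>x y. Vector_Spaces.linear s1 s2 (F x y)"
  shows "Vector_Spaces.linear s1 s2 (\<lambda>v. pair_sum ps (\<lambda>x y. F x y v))"
  using assms(1,2) lin[unfolded linear_iff_vs]
  by (simp add: linear_iff_vs pair_sum_add pair_sum_scale[OF assms(2)])

lemma pair_sum_mult_right: "pair_sum ps F * (c :: 'c::ring) = pair_sum ps (\<lambda>x y. F x y * c)"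
  by (induction ps) (simp_all add: distrib_right)

section \<open>Multilinear maps and the evaluation of tensor lifts\<close>

lemma bilinear_mapI:
  assumes "vector_space s" "vector_space sW"
    and "\<And>x x' y. \<beta> (x + x') y = \<beta> x y + \<beta> x' y"
    and "\<And>x y y'. \<beta> x (y + y') = \<beta> x y + \<beta> x y'"
    and "\<And>c x y. \<beta> (s c x) y = sW c (\<beta> x y)"
    and "\<And>c x y. \<beta> x (s c y) = sW c (\<beta> x y)"
  shows "bilinear_map s sW \<beta>"
  using assms by (simp add: bilinear_map_def linear_iff_vs)

lemma bilinear_mapD:
  assumes "bilinear_map s sW \<beta>"
  shows "vector_space s" "vector_space sW"
    "\<beta> (x + x') y = \<beta> x y + \<beta> x' y" "\<beta> x (y + y') = \<beta> x y + \<beta> x y'"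
    "\<beta> (s c x) y = sW c (\<beta> x y)" "\<beta> x (s c y) = sW c (\<beta> x y)"
  using assms by (simp_all add: bilinear_map_def linear_iff_vs)

lemma trilinear_mapI:
  assumes "vector_space s" "vector_space sW"
    and "\<And>x x' y z. \<gamma> (x + x') y z = \<gamma> x y z + \<gamma> x' y z"
    and "\<And>x y y' z. \<gamma> x (y + y') z = \<gamma> x y z + \<gamma> x y' z"
    and "\<And>x y z z'. \<gamma> x y (z + z') = \<gamma> x y z + \<gamma> x y z'"
    and "\<And>c x y z. \<gamma> (s c x) y z = sW c (\<gamma> x y z)"
    and "\<And>c x y z. \<gamma> x (s c y) z = sW c (\<gamma> x y z)"
    and "\<And>c x y z. \<gamma> x y (s c z) = sW c (\<gamma> x y z)"
  shows "trilinear_map s sW \<gamma>"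
  using assms by (simp add: trilinear_map_def linear_iff_vs)

lemma trilinear_mapD:
  assumes "trilinear_map s sW \<gamma>"
  shows "vector_space s" "vector_space sW"
    "\<gamma> (x + x') y z = \<gamma> x y z + \<gamma> x' y z" "\<gamma> x (y + y') z = \<gamma> x y z + \<gamma> x y' z"
    "\<gamma> x y (z + z') = \<gamma> x y z + \<gamma> x y z'"
    "\<gamma> (s c x) y z = sW c (\<gamma> x y z)" "\<gamma> x (s c y) z = sW c (\<gamma> x y z)"
    "\<gamma> x y (s c z) = sW c (\<gamma> x y z)"
  using assms by (simp_all add: trilinear_map_def linear_iff_vs)

lemma subspace_UNIV:
  assumes "vector_space s"
  shows "module.subspace s UNIV"
proof -
  interpret vector_space s by fact
  show ?thesis by simp
qed

text \<open>Since \<open>f\<close> and \<open>g\<close> land in \<open>R\<close> and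
  \<open>S\<close>, any list of pairs becomes an admissible expression after mapping them over it.
  The intended case is \<open>f = g = \<epsilon>\<^sub>t\<close> with
  \<open>R = S = H\<^sub>t\<close>, where \<beta> is controlled only on the subspaces.\<close>

lemma tensor_lift_pair_sum:
  assumes V: "vector_space s" and W: "vector_space sW"
    and R: "module.subspace s R" and S: "module.subspace s S"
    and add1: "\<And>x x' y. x \<in> R \<Longrightarrow> x' \<in> R \<Longrightarrow> y \<in> S \<Longrightarrow> \<beta> (x + x') y = \<beta> x y + \<beta> x' y"
    and add2: "\<And>x y y'. x \<in> R \<Longrightarrow> y \<in> S \<Longrightarrow> y' \<in> S \<Longrightarrow> \<beta> x (y + y') = \<beta> x y + \<beta> x y'"
    and scale1: "\<And>c x y. x \<in> R \<Longrightarrow> y \<in> S \<Longrightarrow> \<beta> (s c x) y = sW c (\<beta> x y)"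
    and scale2: "\<And>c x y. x \<in> R \<Longrightarrow> y \<in> S \<Longrightarrow> \<beta> x (s c y) = sW c (\<beta> x y)"
    and fR: "\<And>x. f x \<in> R" and gS: "\<And>y. g y \<in> S"
  shows "tensor_lift s R S \<beta> (pair_sum ps (\<lambda>x y. tensor s (f x) (g y))) =
    pair_sum ps (\<lambda>x y. \<beta> (f x) (g y))"
proof -
  have "set (map (map_prod f g) ps) \<subseteq> R \<times> S"
    using fR gS by auto
  from tensor_lift_sum[where \<beta> = \<beta>, OF V W R S add1 add2 scale1 scale2 this] show ?thesis
    by (simp add: pair_sum_def comp_def case_prod_unfold)
qed

lemma sweedler_pair_sum:
  assumes "bilinear_map s sW \<beta>"
  shows "sweedler s \<beta> (pair_sum ps (tensor s)) = pair_sum ps \<beta>"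
  using tensor_lift_pair_sum[of s sW UNIV UNIV \<beta> id id ps]
  by (simp add: bilinear_mapD[OF assms] subspace_UNIV)

lemma trilinear_compose:
  assumes "trilinear_map s sW \<gamma>" "Vector_Spaces.linear sW sX \<psi>"
  shows "trilinear_map s sX (\<lambda>x y z. \<psi> (\<gamma> x y z))"
  using assms by (simp add: trilinear_map_def linear_iff_vs)

lemma bilinear_compose:
  assumes "bilinear_map s sW \<beta>" "Vector_Spaces.linear sW sX \<psi>"
  shows "bilinear_map s sX (\<lambda>x y. \<psi> (\<beta> x y))"
  using assms by (simp add: bilinear_map_def linear_iff_vs)

lemma tensor_eval: "bilinear_map s (*) b \<Longrightarrow> tensor s x y b = b x y"
  by (simp add: tensor_def)

lemma tensor3_eval: "trilinear_map s (*) b \<Longrightarrow> tensor3 s x y z b = b x y z"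
  by (simp add: tensor3_def)

lemma tensor3_lift_pair_sum:
  assumes "trilinear_map s sW \<gamma>"
  shows "tensor3_lift s \<gamma> (pair_sum ps (\<lambda>x y. tensor3 s (f x y) (g x y) (h x y))) =
    pair_sum ps (\<lambda>x y. \<gamma> (f x y) (g x y) (h x y))"
  using tensor3_lift_sum[OF trilinear_mapD(2)[OF assms] assms,
      of "map (\<lambda>(x, y). (f x y, g x y, h x y)) ps"]
  by (simp add: pair_sum_def comp_def case_prod_unfold)

section \<open>Choosing expressions of the comultiplication as sums of pure tensors\<close>

context coalgebra
begin

text \<open>An arbitrary choice, so the list itself does not depend linearly on \<open>h\<close>.
  Only sums of bilinear maps over it have invariant meaning.\<close>

definition sweedler_list :: "'h \<Rightarrow> ('h \<times> 'h) list"
  where "sweedler_list h = (SOME ps. \<Delta> h = pair_sum ps (tensor scale))"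

lemma vector_space_scale: "vector_space scale"
  by unfold_locales

lemma comult_eq: "\<Delta> h = pair_sum (sweedler_list h) (tensor scale)"
proof -
  have "\<exists>ps. \<Delta> h = pair_sum ps (tensor scale)"
    using comult_in[of h] by (auto simp: tensor_space_def pair_sum_def)
  then show ?thesis
    unfolding sweedler_list_def by (rule someI_ex)
qed

lemma sweedler_comult:
  assumes "bilinear_map scale sW \<beta>"
  shows "sweedler scale \<beta> (\<Delta> h) = pair_sum (sweedler_list h) \<beta>"
  using sweedler_pair_sum[OF assms, of "sweedler_list h"] comult_eq[of h] by argo

lemma counit_add: "\<epsilon> (x + y) = \<epsilon> x + \<epsilon> y"
  and counit_scale: "\<epsilon> (scale c x) = c * \<epsilon> x"
  using linear_counit by (auto simp: linear_iff_vs)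

text \<open>The lists chosen at \<open>x\<close>, \<open>y\<close> and \<open>x + y\<close> are
  unrelated. After a functional \<psi> is applied, however, the sum is the value of
  \<open>\<Delta> h\<close> at the bilinear form \<psi> \<circ> \<beta>, which is linear in
  \<open>h\<close>; functionals separate points.\<close>

lemma linear_sweedler_list:
  assumes \<beta>: "bilinear_map scale sW \<beta>"
  shows "Vector_Spaces.linear scale sW (\<lambda>h. pair_sum (sweedler_list h) \<beta>)"
proof -
  have W: "vector_space sW"
    by (rule bilinear_mapD(2)[OF \<beta>])
  have eval: "\<psi> (pair_sum (sweedler_list h) \<beta>) = \<Delta> h (\<lambda>x y. \<psi> (\<beta> x y))"
    if \<psi>: "Vector_Spaces.linear sW (*) \<psi>" for \<psi> h
    by (simp add: comult_eq pair_sum_apply tensor_eval[OF bilinear_compose[OF \<beta> \<psi>]]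
        linear_pair_sum[OF \<psi>])
  have \<Delta>: "\<Delta> (x + y) = \<Delta> x + \<Delta> y" "\<Delta> (scale c x) = tensor_scale c (\<Delta> x)" for c x y
    using linear_comult by (auto simp: linear_iff_vs)
  have "pair_sum (sweedler_list (x + y)) \<beta> =
      pair_sum (sweedler_list x) \<beta> + pair_sum (sweedler_list y) \<beta>" for x y
  proof (rule eq_by_functionals[OF W])
    fix \<psi> assume \<psi>: "Vector_Spaces.linear sW (*) \<psi>"
    then show "\<psi> (pair_sum (sweedler_list (x + y)) \<beta>) =
        \<psi> (pair_sum (sweedler_list x) \<beta> + pair_sum (sweedler_list y) \<beta>)"
      using \<psi>[unfolded linear_iff_vs] by (simp add: eval \<Delta>)
  qed
  moreover have "pair_sum (sweedler_list (scale c x)) \<beta> = sW c (pair_sum (sweedler_list x) \<beta>)" for c x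
  proof (rule eq_by_functionals[OF W])
    fix \<psi> assume \<psi>: "Vector_Spaces.linear sW (*) \<psi>"
    then show "\<psi> (pair_sum (sweedler_list (scale c x)) \<beta>) =
        \<psi> (sW c (pair_sum (sweedler_list x) \<beta>))"
      using \<psi>[unfolded linear_iff_vs] by (simp add: eval \<Delta> tensor_scale_def)
  qed
  ultimately show ?thesis
    using W vector_space_scale by (simp add: linear_iff_vs)
qed

text \<open>Puts (id \<otimes> \<Delta>)(\<Delta> h) into list form. Unfolding the outer Sweedler
  sum requires the inner one to be linear in \<open>b\<close>, which
  \<open>linear_sweedler_list\<close> provides.\<close>

lemma comult_right_sum:
  "sweedler scale (\<lambda>a b. sweedler scale (\<lambda>b1 b2. tensor3 scale a b1 b2) (\<Delta> b)) (\<Delta> h) =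
    pair_sum (sweedler_list h) (\<lambda>a b. pair_sum (sweedler_list b) (\<lambda>b1 b2. tensor3 scale a b1 b2))"
proof -
  note t = trilinear_mapD[OF trilinear_tensor3[OF vector_space_scale]]
  have b: "bilinear_map scale tensor_scale (\<lambda>b1 b2. tensor3 scale a b1 b2)" for a
    by (rule bilinear_mapI) (simp_all add: t)
  note l = linear_sweedler_list[OF b, unfolded linear_iff_vs]
  have "bilinear_map scale tensor_scale
      (\<lambda>a b. pair_sum (sweedler_list b) (\<lambda>b1 b2. tensor3 scale a b1 b2))"
    by (rule bilinear_mapI) (use l in \<open>simp_all add: t pair_sum_add pair_sum_scale[OF t(2)]\<close>)
  then show ?thesis
    by (simp add: sweedler_comult[OF b] sweedler_comult)
qed

end

section \<open>Unit, multiplicativity and counit axioms in list form\<close>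

context weak_bialgebra
begin

abbreviation \<epsilon>\<^sub>t :: "'h \<Rightarrow> 'h"
  where "\<epsilon>\<^sub>t \<equiv> target_counital scale \<Delta> \<epsilon>"

abbreviation H\<^sub>t :: "'h set"
  where "H\<^sub>t \<equiv> target_subalgebra scale \<Delta> \<epsilon>"

abbreviation \<Delta>1 :: "('h \<times> 'h) list"
  where "\<Delta>1 \<equiv> sweedler_list 1"

lemmas multilinear_simps = counit_add counit_scale scale_mult_left scale_mult_right
  distrib_left distrib_right scale_left_distrib scale_right_distrib scale_scale mult_ac
  bilinear_mapD(3-)[OF bilinear_tensor[OF vector_space_scale]]

text \<open>The axioms speak of (\<Delta> \<otimes> id)(\<Delta> 1); coassociativity moves them to
  (id \<otimes> \<Delta>)(\<Delta> 1), and the two products are then multiplied out legwise.\<close>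

lemma unit_eqs:
  "pair_sum \<Delta>1 (\<lambda>a b. pair_sum (sweedler_list b) (\<lambda>b1 b2. tensor3 scale a b1 b2)) =
    pair_sum \<Delta>1 (\<lambda>a b. pair_sum \<Delta>1 (\<lambda>c d. tensor3 scale a (c * b) d))" (is ?right)
  "pair_sum \<Delta>1 (\<lambda>a b. pair_sum (sweedler_list b) (\<lambda>b1 b2. tensor3 scale a b1 b2)) =
    pair_sum \<Delta>1 (\<lambda>a b. pair_sum \<Delta>1 (\<lambda>c d. tensor3 scale a (b * c) d))" (is ?left)
proof -
  note t = trilinear_mapD[OF trilinear_tensor3[OF vector_space_scale]]
  have b1: "bilinear_map scale tensor_scale (\<lambda>a b. tensor3 scale a b 1)"
    and b2: "bilinear_map scale tensor_scale (\<lambda>a b. tensor3 scale 1 a b)"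
    by (rule bilinear_mapI; simp add: t)+
  have t1: "trilinear_map scale tensor_scale
      (\<lambda>a' b' c'. tensor3 scale (a * a') (b * b') (c * c'))" for a b c
    by (rule trilinear_mapI) (simp_all add: t distrib_left scale_mult_right)
  have t2: "trilinear_map scale tensor_scale
      (\<lambda>a b c. pair_sum \<Delta>1 (\<lambda>x y. tensor3 scale (a * f x y) (b * g x y) (c * h x y)))" for f g h
    by (rule trilinear_mapI)
      (simp_all add: t distrib_right scale_mult_left pair_sum_add pair_sum_scale[OF t(2)])
  have mult: "mult_tensor3 scale
      (pair_sum \<Delta>1 (\<lambda>x y. tensor3 scale (f x y) (g x y) (h x y)))
      (pair_sum \<Delta>1 (\<lambda>x y. tensor3 scale (f' x y) (g' x y) (h' x y))) =
      pair_sum \<Delta>1 (\<lambda>x y. pair_sum \<Delta>1 (\<lambda>z w.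
        tensor3 scale (f x y * f' z w) (g x y * g' z w) (h x y * h' z w)))" for f g h f' g' h'
    by (simp add: mult_tensor3_def tensor3_lift_pair_sum[OF t1] tensor3_lift_pair_sum[OF t2])
  show ?right
    unfolding comult_right_sum[symmetric] coassoc[symmetric] unit_right
      sweedler_comult[OF b1] sweedler_comult[OF b2] mult
    \<comment> \<open>In this order of the factors the outer sum comes from 1 \<otimes> \<Delta> 1,
      so the two sums are exchanged to put the pair \<open>a\<close>, \<open>b\<close>
      outside.\<close>
    by (subst pair_sum_swap) simp
  show ?left
    unfolding comult_right_sum[symmetric] coassoc[symmetric] unit_left
      sweedler_comult[OF b1] sweedler_comult[OF b2] mult
    by simp
qed

text \<open>Carries the identity in the triple tensor power to an arbitrary trilinear map: a tensor
  is a functional on forms, so both sides are evaluated at \<psi> \<circ> \<gamma> for every linear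
  functional \<psi>.\<close>

lemma comult_unit_right:
  assumes \<gamma>: "trilinear_map scale sW \<gamma>"
  shows "pair_sum \<Delta>1 (\<lambda>a b. pair_sum (sweedler_list b) (\<gamma> a)) =
    pair_sum \<Delta>1 (\<lambda>a b. pair_sum \<Delta>1 (\<lambda>c d. \<gamma> a (c * b) d))"
proof (rule eq_by_functionals[OF trilinear_mapD(2)[OF \<gamma>]])
  fix \<psi> assume \<psi>: "Vector_Spaces.linear sW (*) \<psi>"
  show "\<psi> (pair_sum \<Delta>1 (\<lambda>a b. pair_sum (sweedler_list b) (\<gamma> a))) =
      \<psi> (pair_sum \<Delta>1 (\<lambda>a b. pair_sum \<Delta>1 (\<lambda>c d. \<gamma> a (c * b) d)))"
    using fun_cong[OF unit_eqs(1), of "\<lambda>x y z. \<psi> (\<gamma> x y z)"]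
    by (simp add: pair_sum_apply tensor3_eval[OF trilinear_compose[OF \<gamma> \<psi>]]
        linear_pair_sum[OF \<psi>])
qed

lemma comult_unit_left:
  assumes \<gamma>: "trilinear_map scale sW \<gamma>"
  shows "pair_sum \<Delta>1 (\<lambda>a b. pair_sum (sweedler_list b) (\<gamma> a)) =
    pair_sum \<Delta>1 (\<lambda>a b. pair_sum \<Delta>1 (\<lambda>c d. \<gamma> a (b * c) d))"
proof (rule eq_by_functionals[OF trilinear_mapD(2)[OF \<gamma>]])
  fix \<psi> assume \<psi>: "Vector_Spaces.linear sW (*) \<psi>"
  show "\<psi> (pair_sum \<Delta>1 (\<lambda>a b. pair_sum (sweedler_list b) (\<gamma> a))) =
      \<psi> (pair_sum \<Delta>1 (\<lambda>a b. pair_sum \<Delta>1 (\<lambda>c d. \<gamma> a (b * c) d)))"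
    using fun_cong[OF unit_eqs(2), of "\<lambda>x y z. \<psi> (\<gamma> x y z)"]
    by (simp add: pair_sum_apply tensor3_eval[OF trilinear_compose[OF \<gamma> \<psi>]]
        linear_pair_sum[OF \<psi>])
qed

lemma sweedler_list_mult:
  assumes \<beta>: "bilinear_map scale sW \<beta>"
  shows "pair_sum (sweedler_list (g * h)) \<beta> =
    pair_sum (sweedler_list g) (\<lambda>a b. pair_sum (sweedler_list h) (\<lambda>c d. \<beta> (a * c) (b * d)))"
proof (rule eq_by_functionals[OF bilinear_mapD(2)[OF \<beta>]])
  fix \<psi> assume \<psi>: "Vector_Spaces.linear sW (*) \<psi>"
  have b1: "bilinear_map scale tensor_scale (\<lambda>c d. tensor scale (a * c) (b * d))" for a b
    by (rule bilinear_mapI)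
      (simp_all add: multilinear_simps vector_space_scale vector_space_tensor_scale)
  have b2: "bilinear_map scale tensor_scale
      (\<lambda>a b. pair_sum (sweedler_list h) (\<lambda>c d. tensor scale (a * c) (b * d)))"
    by (rule bilinear_mapI)
      (simp_all add: multilinear_simps vector_space_scale vector_space_tensor_scale
        pair_sum_add pair_sum_scale[OF vector_space_tensor_scale])
  have "pair_sum (sweedler_list (g * h)) (tensor scale) =
      pair_sum (sweedler_list g) (\<lambda>a b. pair_sum (sweedler_list h)
        (\<lambda>c d. tensor scale (a * c) (b * d)))"
    unfolding comult_eq[symmetric] comult_mult mult_tensor_def
    by (simp add: sweedler_comult[OF b1] sweedler_comult[OF b2])
  from fun_cong[OF this, of "\<lambda>x y. \<psi> (\<beta> x y)"]
  show "\<psi> (pair_sum (sweedler_list (g * h)) \<beta>) = \<psi> (pair_sum (sweedler_list g)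
      (\<lambda>a b. pair_sum (sweedler_list h) (\<lambda>c d. \<beta> (a * c) (b * d))))"
    by (simp add: pair_sum_apply tensor_eval[OF bilinear_compose[OF \<beta> \<psi>]]
        linear_pair_sum[OF \<psi>])
qed

lemma counit_left_sum: "pair_sum (sweedler_list h) (\<lambda>a b. scale (\<epsilon> a) b) = h"
proof -
  have "bilinear_map scale scale (\<lambda>a b. scale (\<epsilon> a) b)"
    by (rule bilinear_mapI) (simp_all add: multilinear_simps vector_space_scale)
  from sweedler_comult[OF this] show ?thesis
    by (simp add: counit_left)
qed

lemma counit_mult_sum:
  "pair_sum (sweedler_list g) (\<lambda>a b. \<epsilon> (f * a) * \<epsilon> (b * h)) = \<epsilon> (f * g * h)"
  "pair_sum (sweedler_list g) (\<lambda>a b. \<epsilon> (f * b) * \<epsilon> (a * h)) = \<epsilon> (f * g * h)"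
proof -
  have b1: "bilinear_map scale (*) (\<lambda>a b. \<epsilon> (f * a) * \<epsilon> (b * h))"
    and b2: "bilinear_map scale (*) (\<lambda>a b. \<epsilon> (f * b) * \<epsilon> (a * h))"
    by (rule bilinear_mapI;
        simp add: multilinear_simps vector_space_scale vector_space_times)+
  show "pair_sum (sweedler_list g) (\<lambda>a b. \<epsilon> (f * a) * \<epsilon> (b * h)) = \<epsilon> (f * g * h)"
    by (simp only: counit_mult sweedler_comult[OF b1])
  show "pair_sum (sweedler_list g) (\<lambda>a b. \<epsilon> (f * b) * \<epsilon> (a * h)) = \<epsilon> (f * g * h)"
    by (simp only: counit_mult' sweedler_comult[OF b2])
qed

section \<open>The target counital map and its image\<close>

lemma target_counital_sum: "\<epsilon>\<^sub>t h = pair_sum \<Delta>1 (\<lambda>a b. scale (\<epsilon> (a * h)) b)"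
proof -
  have "bilinear_map scale scale (\<lambda>a b. scale (\<epsilon> (a * h)) b)"
    by (rule bilinear_mapI) (simp_all add: multilinear_simps vector_space_scale)
  from sweedler_comult[OF this] show ?thesis
    by (simp add: target_counital_def)
qed

lemma linear_target_counital: "Vector_Spaces.linear scale scale \<epsilon>\<^sub>t"
  unfolding target_counital_sum
  by (rule linear_pair_sumI)
    (simp_all add: linear_iff_vs multilinear_simps vector_space_scale)

lemma linear_counit_mult_left: "Vector_Spaces.linear scale (*) (\<lambda>x. \<epsilon> (g * x))"
  by (simp add: linear_iff_vs multilinear_simps vector_space_scale vector_space_times)

lemma linear_scale_left: "Vector_Spaces.linear (*) scale (\<lambda>c. scale c x)"
  by (simp add: linear_iff_vs multilinear_simps vector_space_scale vector_space_times)

text \<open>Expanding \<open>\<epsilon>\<^sub>t h\<close> gives \<Sum> \<epsilon>(a h) \<epsilon>(g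
  b), which is the second counit axiom with middle factor 1.\<close>

lemma counit_mult_target_counital: "\<epsilon> (g * \<epsilon>\<^sub>t h) = \<epsilon> (g * h)"
  using counit_mult_sum(2)[of 1 g h]
  unfolding target_counital_sum linear_pair_sum[OF linear_counit_mult_left]
  by (simp add: multilinear_simps)

text \<open>\<open>\<epsilon>\<^sub>t h\<close> depends on \<open>h\<close> only through the scalars
  \<epsilon>(a h), and these are unchanged when \<open>h\<close> is replaced by
  \<open>\<epsilon>\<^sub>t h\<close>.\<close>

lemma target_counital_idem: "\<epsilon>\<^sub>t (\<epsilon>\<^sub>t h) = \<epsilon>\<^sub>t h"
  by (simp add: target_counital_sum[of "\<epsilon>\<^sub>t h"] counit_mult_target_counital)
    (simp add: target_counital_sum)

lemma mem_target_subalgebra_iff: "z \<in> H\<^sub>t \<longleftrightarrow> \<epsilon>\<^sub>t z = z"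
  unfolding target_subalgebra_def using target_counital_idem by (metis imageE rangeI)

lemma comult_unit_target_counital:
  assumes \<beta>: "bilinear_map scale sW \<beta>"
  shows "pair_sum \<Delta>1 (\<lambda>a b. \<beta> a (\<epsilon>\<^sub>t b)) = pair_sum \<Delta>1 \<beta>"
proof -
  note l = bilinear_mapD[OF \<beta>]
  interpret W: vector_space sW by (rule l(2))
  \<comment> \<open>Contracts the middle leg with \<epsilon>: the counit axiom collapses \<Sum> a
    \<otimes> \<Delta> b to \<Sum> a \<otimes> b, while \<Sum> a \<otimes> c b \<otimes> d becomes
    \<Sum> a \<otimes> \<open>\<epsilon>\<^sub>t b\<close>.\<close>
  have \<gamma>: "trilinear_map scale sW (\<lambda>x y z. \<beta> x (scale (\<epsilon> y) z))"
    by (rule trilinear_mapI)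
      (simp_all add: l multilinear_simps W.scale_left_distrib W.scale_right_distrib mult_ac)
  have lin: "Vector_Spaces.linear scale sW (\<beta> a)" for a
    using \<beta> by (simp add: bilinear_map_def)
  show ?thesis
    using comult_unit_right[OF \<gamma>]
    unfolding linear_pair_sum[OF lin, symmetric] counit_left_sum target_counital_sum by simp
qed

text \<open>Reduces a linear expression in \<open>z\<close> to its values at the second legs
  \<open>b\<close> of \<Delta> 1, where the unit axioms apply. Read backwards, it restores
  \<open>z\<close> afterwards.\<close>

lemma target_expand:
  assumes f: "Vector_Spaces.linear scale sW f" and z: "z \<in> H\<^sub>t"
  shows "f z = pair_sum \<Delta>1 (\<lambda>a b. sW (\<epsilon> (a * z)) (f b))"
proof -
  have "f z = f (\<epsilon>\<^sub>t z)"
    using z by (simp add: mem_target_subalgebra_iff)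
  also have "\<dots> = pair_sum \<Delta>1 (\<lambda>a b. sW (\<epsilon> (a * z)) (f b))"
    unfolding target_counital_sum linear_pair_sum[OF f] using f by (simp add: linear_iff_vs)
  finally show ?thesis .
qed

lemma comult_target:
  assumes z: "z \<in> H\<^sub>t" and \<beta>: "bilinear_map scale sW \<beta>"
  shows "pair_sum (sweedler_list z) \<beta> = pair_sum \<Delta>1 (\<lambda>c d. \<beta> (c * z) d)"
proof -
  note l = bilinear_mapD[OF \<beta>]
  interpret W: vector_space sW by (rule l(2))
  have \<gamma>: "trilinear_map scale sW (\<lambda>x y w. sW (\<epsilon> (x * z)) (\<beta> y w))"
    by (rule trilinear_mapI)
      (simp_all add: l multilinear_simps W.scale_left_distrib W.scale_right_distrib)
  have lin1: "Vector_Spaces.linear scale sW (\<lambda>h. pair_sum (sweedler_list h) \<beta>)"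
    by (rule linear_sweedler_list[OF \<beta>])
  have lin2: "Vector_Spaces.linear scale sW (\<lambda>x. pair_sum \<Delta>1 (\<lambda>c d. \<beta> (c * x) d))"
    by (rule linear_pair_sumI) (simp_all add: linear_iff_vs l multilinear_simps)
  have "pair_sum (sweedler_list z) \<beta> =
      pair_sum \<Delta>1 (\<lambda>a b. sW (\<epsilon> (a * z)) (pair_sum (sweedler_list b) \<beta>))"
    by (rule target_expand[OF lin1 z])
  \<comment> \<open>The unit axiom, with first leg contracted by \<epsilon>(_ z), replaces \<Delta>
    b by \<Sum> c b \<otimes> d.\<close>
  also have "\<dots> = pair_sum \<Delta>1 (\<lambda>a b. sW (\<epsilon> (a * z)) (pair_sum \<Delta>1 (\<lambda>c d. \<beta> (c * b) d)))"
    using comult_unit_right[OF \<gamma>] by (simp add: pair_sum_scale[OF l(2)])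
  also have "\<dots> = pair_sum \<Delta>1 (\<lambda>c d. \<beta> (c * z) d)"
    by (rule target_expand[OF lin2 z, symmetric])
  finally show ?thesis .
qed

text \<open>Shows that \<open>x * y\<close> is fixed by \<open>\<epsilon>\<^sub>t\<close>: apply
  \<epsilon> \<otimes> id to \<Delta>(x) \<Delta>(y), substitute \<open>comult_target\<close> for
  \<open>y\<close>, regroup, and substitute it for \<open>x\<close>.\<close>

lemma target_subalgebra_mult:
  assumes x: "x \<in> H\<^sub>t" and y: "y \<in> H\<^sub>t"
  shows "x * y \<in> H\<^sub>t"
proof -
  have b1: "bilinear_map scale scale (\<lambda>p q. scale (\<epsilon> p) q)"
    and b2: "bilinear_map scale scale (\<lambda>c d. scale (\<epsilon> (a * c)) (b * d))"
    and b3: "bilinear_map scale scale (\<lambda>p q. scale (\<epsilon> (p * y)) q)" for a b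
    by (rule bilinear_mapI; simp add: multilinear_simps vector_space_scale)+
  have "x * y = pair_sum (sweedler_list (x * y)) (\<lambda>p q. scale (\<epsilon> p) q)"
    by (simp add: counit_left_sum)
  also have "\<dots> = pair_sum (sweedler_list x)
      (\<lambda>a b. pair_sum \<Delta>1 (\<lambda>c d. scale (\<epsilon> (a * (c * y))) (b * d)))"
    by (simp add: sweedler_list_mult[OF b1] comult_target[OF y b2])
  \<comment> \<open>With \<open>y\<close> moved into the form, the double sum runs over \<Delta>(x)
    \<Delta>(1). The factor 1 is kept so that multiplicativity can fold this into \<Delta>(x
    1).\<close>
  also have "\<dots> = pair_sum (sweedler_list (x * 1)) (\<lambda>p q. scale (\<epsilon> (p * y)) q)"
    by (simp add: sweedler_list_mult[OF b3] mult.assoc del: mult_1_right)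
  also have "\<dots> = \<epsilon>\<^sub>t (x * y)"
    by (simp add: comult_target[OF x b3] target_counital_sum mult.assoc)
  finally show ?thesis
    by (simp add: mem_target_subalgebra_iff)
qed

lemma subalgebra_target: "subalgebra scale H\<^sub>t"
proof -
  interpret t: Vector_Spaces.linear scale scale \<epsilon>\<^sub>t
    by (rule linear_target_counital)
  have "subspace H\<^sub>t"
    by (rule subspaceI) (simp_all add: mem_target_subalgebra_iff t.zero t.add t.scale)
  \<comment> \<open>For \<open>h = 1\<close> the definition of \<open>\<epsilon>\<^sub>t\<close> is
    the left counit axiom at 1.\<close>
  moreover have "1 \<in> H\<^sub>t"
    by (simp add: mem_target_subalgebra_iff target_counital_sum counit_left_sum)
  ultimately show ?thesis
    by (simp add: subalgebra_def target_subalgebra_mult unital_algebra_axioms)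
qed

section \<open>The Frobenius and idempotency identities\<close>

lemma target_counital_mem: "\<epsilon>\<^sub>t x \<in> H\<^sub>t"
  by (simp add: target_subalgebra_def)

lemma frobenius_left:
  assumes z: "z \<in> H\<^sub>t"
  shows "pair_sum \<Delta>1 (\<lambda>a b. scale (\<epsilon> (z * \<epsilon>\<^sub>t a)) b) = z"
proof -
  have lin1: "Vector_Spaces.linear scale scale (\<lambda>x. pair_sum \<Delta>1 (\<lambda>c d. scale (\<epsilon> (x * c)) d))"
    and lin2: "Vector_Spaces.linear scale scale (\<lambda>x. pair_sum \<Delta>1 (\<lambda>c d. scale (\<epsilon> (c * x)) d))"
    by (rule linear_pair_sumI;
        simp add: linear_iff_vs multilinear_simps vector_space_scale)+
  have \<gamma>: "trilinear_map scale scale (\<lambda>x y w. scale (\<epsilon> (x * z)) (scale (\<epsilon> y) w))"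
    by (rule trilinear_mapI) (simp_all add: multilinear_simps vector_space_scale)
  have "pair_sum \<Delta>1 (\<lambda>c d. scale (\<epsilon> (z * c)) d) =
      pair_sum \<Delta>1 (\<lambda>a b. scale (\<epsilon> (a * z)) (pair_sum \<Delta>1 (\<lambda>c d. scale (\<epsilon> (b * c)) d)))"
    by (rule target_expand[OF lin1 z])
  \<comment> \<open>Both \<Sum> a \<otimes> b c \<otimes> d and \<Sum> a \<otimes> c b \<otimes> d
    equal \<Sum> a \<otimes> \<Delta> b, so the middle product may be reversed.\<close>
  also have "\<dots> = pair_sum \<Delta>1 (\<lambda>a b. scale (\<epsilon> (a * z)) (pair_sum \<Delta>1 (\<lambda>c d. scale (\<epsilon> (c * b)) d)))"
    using comult_unit_left[OF \<gamma>] comult_unit_right[OF \<gamma>]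
    by (simp add: pair_sum_scale[OF vector_space_scale] del: scale_scale)
  also have "\<dots> = pair_sum \<Delta>1 (\<lambda>c d. scale (\<epsilon> (c * z)) d)"
    by (rule target_expand[OF lin2 z, symmetric])
  also have "\<dots> = z"
    using z by (simp add: mem_target_subalgebra_iff target_counital_sum)
  finally show ?thesis
    by (simp add: counit_mult_target_counital)
qed

lemma frobenius_right:
  assumes z: "z \<in> H\<^sub>t"
  shows "pair_sum \<Delta>1 (\<lambda>a b. scale (\<epsilon> (b * z)) (\<epsilon>\<^sub>t a)) = z"
proof -
  have "pair_sum \<Delta>1 (\<lambda>a b. scale (\<epsilon> (b * z)) (\<epsilon>\<^sub>t a)) =
      pair_sum \<Delta>1 (\<lambda>c d. scale (pair_sum \<Delta>1 (\<lambda>a b. \<epsilon> (c * a) * \<epsilon> (b * z))) d)"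
    unfolding target_counital_sum pair_sum_scale[OF vector_space_scale, symmetric]
      linear_pair_sum[OF linear_scale_left]
    \<comment> \<open>After the exchange, the coefficient of \<open>d\<close> has the shape of the
      first counit axiom with middle factor 1, hence equals \<epsilon>(c z).\<close>
    by (subst pair_sum_swap) (simp add: mult.commute)
  also have "\<dots> = \<epsilon>\<^sub>t z"
    by (simp add: counit_mult_sum(1) target_counital_sum)
  finally show ?thesis
    using z by (simp add: mem_target_subalgebra_iff)
qed

lemma frobenius_idempotent: "pair_sum \<Delta>1 (\<lambda>a b. \<epsilon>\<^sub>t a * b) = 1"
proof -
  have b: "bilinear_map scale scale (\<lambda>p q. scale (\<epsilon> p) q)"
    by (rule bilinear_mapI) (simp_all add: multilinear_simps vector_space_scale)
  have "pair_sum \<Delta>1 (\<lambda>a b. \<epsilon>\<^sub>t a * b) =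
      pair_sum \<Delta>1 (\<lambda>c d. pair_sum \<Delta>1 (\<lambda>a b. scale (\<epsilon> (c * a)) (d * b)))"
    unfolding target_counital_sum pair_sum_mult_right
    by (subst pair_sum_swap) (simp add: scale_mult_left)
  \<comment> \<open>The double sum is \<epsilon> \<otimes> id applied to \<Delta>(1) \<Delta>(1) =
    \<Delta>(1 1).\<close>
  also have "\<dots> = 1"
    using sweedler_list_mult[OF b, of 1 1] by (simp add: counit_left_sum)
  finally show ?thesis .
qed

section \<open>The Frobenius element as a tensor over the target subalgebra\<close>

lemma tensor_map_comult_unit:
  "tensor_map scale \<epsilon>\<^sub>t id (\<Delta> 1) = pair_sum \<Delta>1 (\<lambda>a b. tensor scale (\<epsilon>\<^sub>t a) (\<epsilon>\<^sub>t b))"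
proof -
  interpret t: Vector_Spaces.linear scale scale \<epsilon>\<^sub>t
    by (rule linear_target_counital)
  have b: "bilinear_map scale tensor_scale (\<lambda>a b. tensor scale (\<epsilon>\<^sub>t a) b)"
    by (rule bilinear_mapI)
      (simp_all add: t.add t.scale multilinear_simps vector_space_scale vector_space_tensor_scale)
  show ?thesis
    \<comment> \<open>Inserting \<open>\<epsilon>\<^sub>t\<close> in the second leg leaves the
      tensor unchanged and makes both legs visibly elements of \<open>H\<^sub>t\<close>.\<close>
    by (simp add: tensor_map_def sweedler_comult[OF b] comult_unit_target_counital[OF b])
qed

text \<open>Two maps are used because the integrands of the Frobenius conditions contain
  \<open>restrict \<epsilon> H\<^sub>t\<close>, which is \<open>undefined\<close> off
  \<open>H\<^sub>t\<close>; they only agree on \<open>H\<^sub>t\<close> with a globally bilinear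
  \<beta>. That global bilinearity lets \<open>\<epsilon>\<^sub>t\<close> be dropped from the second
  leg at the end.\<close>

lemma tensor_lift_target:
  assumes \<beta>: "bilinear_map scale sW \<beta>"
    and \<beta>': "\<And>x y. x \<in> H\<^sub>t \<Longrightarrow> y \<in> H\<^sub>t \<Longrightarrow> \<beta>' x y = \<beta> x y"
  shows "tensor_lift scale H\<^sub>t H\<^sub>t \<beta>' (tensor_map scale \<epsilon>\<^sub>t id (\<Delta> 1)) =
    pair_sum \<Delta>1 (\<lambda>a b. \<beta> (\<epsilon>\<^sub>t a) b)"
proof -
  interpret t: Vector_Spaces.linear scale scale \<epsilon>\<^sub>t
    by (rule linear_target_counital)
  note l = bilinear_mapD[OF \<beta>]
  have sub: "subspace H\<^sub>t"
    using subalgebra_target by (simp add: subalgebra_def)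
  have "tensor_lift scale H\<^sub>t H\<^sub>t \<beta>' (tensor_map scale \<epsilon>\<^sub>t id (\<Delta> 1)) =
      pair_sum \<Delta>1 (\<lambda>a b. \<beta>' (\<epsilon>\<^sub>t a) (\<epsilon>\<^sub>t b))"
    unfolding tensor_map_comult_unit
    by (rule tensor_lift_pair_sum[OF l(1,2) sub sub])
      (simp_all add: \<beta>' l subspace_add[OF sub] subspace_scale[OF sub] target_counital_mem)
  also have "\<dots> = pair_sum \<Delta>1 (\<lambda>a b. \<beta> (\<epsilon>\<^sub>t a) (\<epsilon>\<^sub>t b))"
    by (simp add: \<beta>' target_counital_mem)
  also have "\<dots> = pair_sum \<Delta>1 (\<lambda>a b. \<beta> (\<epsilon>\<^sub>t a) b)"
    by (rule comult_unit_target_counital, rule bilinear_mapI) (simp_all add: l t.add t.scale)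
  finally show ?thesis .
qed

lemma idempotent_frobenius_system_target:
  "idempotent_frobenius_system scale H\<^sub>t (restrict \<epsilon> H\<^sub>t) (tensor_map scale \<epsilon>\<^sub>t id (\<Delta> 1))"
proof -
  let ?e = "tensor_map scale \<epsilon>\<^sub>t id (\<Delta> 1)"
  let ?\<phi> = "restrict \<epsilon> H\<^sub>t"
  have sub: "subspace H\<^sub>t"
    using subalgebra_target by (simp add: subalgebra_def)
  have "?e \<in> tensor_space scale H\<^sub>t H\<^sub>t"
    unfolding tensor_space_def tensor_map_comult_unit
    by (rule CollectI, rule exI[of _ "map (map_prod \<epsilon>\<^sub>t \<epsilon>\<^sub>t) \<Delta>1"])
      (auto simp: pair_sum_def comp_def case_prod_unfold target_counital_mem)
  moreover have "tensor_lift scale H\<^sub>t H\<^sub>t (\<lambda>e1 e2. scale (?\<phi> (r * e1)) e2) ?e = r"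
    if r: "r \<in> H\<^sub>t" for r
  proof -
    have b: "bilinear_map scale scale (\<lambda>e1 e2. scale (\<epsilon> (r * e1)) e2)"
      by (rule bilinear_mapI) (simp_all add: multilinear_simps vector_space_scale)
    show ?thesis
      \<comment> \<open>Closure of \<open>H\<^sub>t\<close> under products puts the argument of the
        restricted counit inside \<open>H\<^sub>t\<close>, where it is \<epsilon>.\<close>
      using tensor_lift_target[OF b] r by (simp add: target_subalgebra_mult frobenius_left)
  qed
  moreover have "tensor_lift scale H\<^sub>t H\<^sub>t (\<lambda>e1 e2. scale (?\<phi> (e2 * r)) e1) ?e = r"
    if r: "r \<in> H\<^sub>t" for r
  proof -
    have b: "bilinear_map scale scale (\<lambda>e1 e2. scale (\<epsilon> (e2 * r)) e1)"
      by (rule bilinear_mapI) (simp_all add: multilinear_simps vector_space_scale)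
    show ?thesis
      using tensor_lift_target[OF b] r by (simp add: target_subalgebra_mult frobenius_right)
  qed
  moreover have "tensor_lift scale H\<^sub>t H\<^sub>t (\<lambda>e1 e2. e1 * e2) ?e = 1"
  proof -
    have b: "bilinear_map scale scale (\<lambda>e1 e2. e1 * e2)"
      by (rule bilinear_mapI) (simp_all add: multilinear_simps vector_space_scale)
    show ?thesis
      using tensor_lift_target[OF b] by (simp add: frobenius_idempotent)
  qed
  ultimately show ?thesis
    by (simp add: idempotent_frobenius_system_def frobenius_system_def subalgebra_target
        counit_add counit_scale subspace_add[OF sub] subspace_scale[OF sub])
qed

end

theorem proposition4p2:
  fixes scale :: "'k::field \<Rightarrow> 'h::{ring, monoid_mult} \<Rightarrow> 'h"
    and \<Delta> :: "'h \<Rightarrow> ('k, 'h) tensor2"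
    and \<epsilon> :: "'h \<Rightarrow> 'k"
  assumes "weak_bialgebra scale \<Delta> \<epsilon>"
  shows "frobenius_separable scale (target_subalgebra scale \<Delta> \<epsilon>) \<and>
    idempotent_frobenius_system scale (target_subalgebra scale \<Delta> \<epsilon>)
      (restrict \<epsilon> (target_subalgebra scale \<Delta> \<epsilon>))
      (tensor_map scale (target_counital scale \<Delta> \<epsilon>) id (\<Delta> 1))"
  using weak_bialgebra.idempotent_frobenius_system_target[OF assms]
  unfolding frobenius_separable_def by blast

end
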